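(* The acyclic polynomial does not encode the number of edges, the bipartiteness or the circumference of a graph. That is: (i) there exist graphs $G,H$ with $A(G,x)=A(H,x)$ and $|E(G)|\ne|E(H)|$; (ii) there exist graphs $G,H$ with $A(G,x)=A(H,x)$ such that $G$ is bipartite and $H$ is not bipartite; (iii) there exist graphs $G,H$ with $A(G,x)=A(H,x)$ that have different circumferences.
   Context: Graphs are finite, undirected and simple. The acyclic polynomial of a graph $G$ is $A(G,x)=\sum_{i\ge 0} a_i x^i$, where $a_i=|\{S\subseteq V(G): |S|=i \text{ and } G[S] \text{ is acyclic}\}|$ and $G[S]$ is the subgraph of $G$ induced by $S$ (acyclic means containing no cycle; the empty set is acyclic). The circumference of a graph is the length of a longest cycle. *)

theory Defs
  imports "HOL-Computational_Algebra.Polynomial"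
begin

record 'a ugraph =
  verts :: "'a set"
  edges :: "'a set set"

definition simple_graph :: "'a ugraph \<Rightarrow> bool" where
  "simple_graph G \<longleftrightarrow>
     finite (verts G) \<and> (\<forall>e\<in>edges G. e \<subseteq> verts G \<and> card e = 2)"

definition induced :: "'a ugraph \<Rightarrow> 'a set \<Rightarrow> 'a ugraph" where
  "induced G S = \<lparr>verts = S, edges = {e \<in> edges G. e \<subseteq> S}\<rparr>"

text \<open>A cycle is given by the list of its vertices in cyclic order, without repeating the
  starting vertex, so its length as a cycle is the length of the list.\<close>

definition is_cycle :: "'a ugraph \<Rightarrow> 'a list \<Rightarrow> bool" where
  "is_cycle G vs \<longleftrightarrow>
     length vs \<ge> 3 \<and> distinct vs \<and> set vs \<subseteq> verts G \<and>
     (\<forall>i. Suc i < length vs \<longrightarrow> {vs ! i, vs ! Suc i} \<in> edges G) \<and>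
     {last vs, hd vs} \<in> edges G"

definition acyclic_graph :: "'a ugraph \<Rightarrow> bool" where
  "acyclic_graph G \<longleftrightarrow> \<not> (\<exists>vs. is_cycle G vs)"

definition acyclic_count :: "'a ugraph \<Rightarrow> nat \<Rightarrow> nat" where
  "acyclic_count G i =
     card {S. S \<subseteq> verts G \<and> card S = i \<and> acyclic_graph (induced G S)}"

text \<open>The coefficients vanish beyond the number of vertices, so the sum may be truncated there.\<close>

definition acyclic_poly :: "'a ugraph \<Rightarrow> int poly" where
  "acyclic_poly G = (\<Sum>i\<le>card (verts G). monom (int (acyclic_count G i)) i)"

definition bipartite :: "'a ugraph \<Rightarrow> bool" where
  "bipartite G \<longleftrightarrow>
     (\<exists>X Y. X \<union> Y = verts G \<and> X \<inter> Y = {} \<and>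
            (\<forall>e\<in>edges G. \<exists>x\<in>X. \<exists>y\<in>Y. e = {x, y}))"

text \<open>Only meaningful for a finite graph with at least one cycle: the maximum of the empty
  set is unspecified.\<close>

definition circumference :: "'a ugraph \<Rightarrow> nat" where
  "circumference G = Max {length vs | vs. is_cycle G vs}"

end

theory Submission
  imports Defs
begin

text \<open>
  A set of vertices induces an acyclic subgraph exactly when it contains no set from a family
  of vertex sets of cycles that is large enough, for instance the vertex sets of all chordless
  cycles. So the acyclic polynomial sees only how many sets of each size contain a
  member of this family, and different families can agree in these numbers.

  For the number of edges this is immediate: on two vertices there is no cycle, so the edge and
  the edgeless graph both have the polynomial \<open>(1 + x)\<^sup>2\<close>.

  For the other two invariants one pair on seven vertices is enough. Let \<open>G\<close> be the cube
  with one vertex deleted, that is, a hexagon together with a centre joined to every second of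
  its vertices, and let \<open>H\<close> be the heptagon \<open>0, ..., 6\<close> with the chords
  \<open>14\<close> and \<open>25\<close>. Neither graph contains a triangle, and each contains three
  4-cycles. In \<open>G\<close> any two of the 4-cycles cover six vertices, so the nine sets that
  arise from a 4-cycle by adding one vertex are distinct; as \<open>G\<close> has no 5-cycle, these
  are its cyclic 5-sets. In \<open>H\<close> the 4-cycles lie in \<open>{1, ..., 5}\<close>, which
  is \<open>K\<^sub>2\<^sub>,\<^sub>3\<close>; they give this 5-set and, with one of the vertices
  \<open>0\<close> and \<open>6\<close> added, six more, and there are two induced 5-cycles, so
  there are again nine cyclic 5-sets. In both graphs all sets of at least six vertices are cyclic.
  Hence the two polynomials are equal, namely to
  \<open>1 + 7x + 21x\<^sup>2 + 35x\<^sup>3 + 32x\<^sup>4 + 12x\<^sup>5\<close>.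

  The graph \<open>G\<close> is bipartite and hence has only even cycles, while \<open>H\<close> has a
  cycle through all of its seven vertices. This odd cycle shows that \<open>H\<close> is not
  bipartite, and it makes the circumference of \<open>H\<close> odd, whereas that of
  \<open>G\<close> is even.
\<close>

section \<open>Cycles\<close>

text \<open>Indices modulo the length treat the closing edge of a cycle like the other edges.\<close>

lemma is_cycle_iff_mod:
  "is_cycle G vs \<longleftrightarrow>
     3 \<le> length vs \<and> distinct vs \<and> set vs \<subseteq> verts G \<and>
     (\<forall>i<length vs. {vs ! i, vs ! (Suc i mod length vs)} \<in> edges G)"
proof (cases "3 \<le> length vs")
  case True
  then have ne: "vs \<noteq> []" by auto
  have "(\<forall>i<length vs. {vs ! i, vs ! (Suc i mod length vs)} \<in> edges G) \<longleftrightarrow>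
      (\<forall>i. Suc i < length vs \<longrightarrow> {vs ! i, vs ! Suc i} \<in> edges G) \<and>
      {last vs, hd vs} \<in> edges G" (is "?cyc \<longleftrightarrow> ?path \<and> ?closing")
  proof
    assume c: ?cyc
    have ?path
    proof (intro allI impI)
      fix i assume "Suc i < length vs"
      then show "{vs ! i, vs ! Suc i} \<in> edges G" using c[rule_format, of i] by simp
    qed
    moreover have ?closing
      using c[rule_format, of "length vs - 1"] ne by (simp add: last_conv_nth hd_conv_nth)
    ultimately show "?path \<and> ?closing" ..
  next
    assume pc: "?path \<and> ?closing"
    show ?cyc
    proof (intro allI impI)
      fix i assume i: "i < length vs"
      show "{vs ! i, vs ! (Suc i mod length vs)} \<in> edges G"
      proof (cases "Suc i < length vs")
        case True
        then show ?thesis using pc by simp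
      next
        case False
        with i have "i = length vs - 1" "Suc i = length vs" by auto
        then show ?thesis using pc ne by (simp add: last_conv_nth hd_conv_nth)
      qed
    qed
  qed
  then show ?thesis by (auto simp: is_cycle_def)
qed (simp add: is_cycle_def)

lemma is_cycle_induced_iff:
  assumes "S \<subseteq> verts G"
  shows "is_cycle (induced G S) vs \<longleftrightarrow> is_cycle G vs \<and> set vs \<subseteq> S"
proof (cases "set vs \<subseteq> S")
  case True
  have "{vs ! i, vs ! (Suc i mod length vs)} \<subseteq> S" if "i < length vs" for i
  proof -
    from that have "Suc i mod length vs < length vs" by (cases "length vs") auto
    with that True show ?thesis by (auto dest: nth_mem)
  qed
  with True assms show ?thesis by (auto simp: is_cycle_iff_mod induced_def)
qed (auto simp: is_cycle_iff_mod induced_def)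

text \<open>The two neighbours are the successor and the predecessor on the cycle; they differ
  because a cycle has length at least three.\<close>

lemma cycle_vertex_two_neighbours:
  assumes "is_cycle G vs" and "v \<in> set vs"
  obtains a b where "a \<in> set vs" "b \<in> set vs" "a \<noteq> b" "{v, a} \<in> edges G" "{v, b} \<in> edges G"
proof -
  let ?L = "length vs"
  from assms(1) have L: "3 \<le> ?L" and d: "distinct vs"
    and e: "\<And>i. i < ?L \<Longrightarrow> {vs ! i, vs ! (Suc i mod ?L)} \<in> edges G"
    by (auto simp: is_cycle_iff_mod)
  from assms(2) obtain i where i: "i < ?L" "v = vs ! i" by (auto simp: in_set_conv_nth)
  define s where "s = Suc i mod ?L"
  define p where "p = (if i = 0 then ?L - 1 else i - 1)"
  have s: "s < ?L" "s = (if Suc i = ?L then 0 else Suc i)" using i L by (auto simp: s_def intro!: mod_less_divisor)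
  have p: "p < ?L" "Suc p mod ?L = i" using i L by (auto simp: p_def)
  have "s \<noteq> p" using i L s(2) by (auto simp: p_def)
  show thesis
  proof
    show "vs ! s \<in> set vs" "vs ! p \<in> set vs" using s p by auto
    show "vs ! s \<noteq> vs ! p" using d s p \<open>s \<noteq> p\<close> by (simp add: nth_eq_iff_index_eq)
    show "{v, vs ! s} \<in> edges G" using e[OF i(1)] i by (simp add: s_def)
    show "{v, vs ! p} \<in> edges G" using e[OF p(1)] p i by (simp add: insert_commute)
  qed
qed

lemma bipartite_cycle_even:
  assumes "bipartite G" and "is_cycle G vs"
  shows "even (length vs)"
proof -
  from assms(1) obtain X Y where XY: "X \<inter> Y = {}"
    "\<forall>e\<in>edges G. \<exists>x\<in>X. \<exists>y\<in>Y. e = {x, y}"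
    by (auto simp: bipartite_def)
  have flip: "u \<in> X \<longleftrightarrow> v \<notin> X" if "{u, v} \<in> edges G" for u v
    using XY that by (fastforce simp: doubleton_eq_iff)
  let ?L = "length vs"
  from assms(2) have L: "3 \<le> ?L"
    and e: "\<And>i. i < ?L \<Longrightarrow> {vs ! i, vs ! (Suc i mod ?L)} \<in> edges G"
    by (auto simp: is_cycle_iff_mod)
  have alt: "vs ! i \<in> X \<longleftrightarrow> (even i \<longleftrightarrow> vs ! 0 \<in> X)" if "i < ?L" for i
    using that
  proof (induction i)
    case (Suc i)
    then show ?case using flip[OF e[of i]] by auto
  qed simp
  have closing: "?L - 1 < ?L" "Suc (?L - 1) = ?L" using L by auto
  then have "vs ! (?L - 1) \<in> X \<longleftrightarrow> vs ! 0 \<notin> X" using flip[OF e[OF closing(1)]] by simp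
  with alt[of "?L - 1"] L have "odd (?L - 1)" by auto
  with L show ?thesis by simp
qed

lemma finite_cycle_lengths:
  assumes "finite (verts G)"
  shows "finite {length vs | vs. is_cycle G vs}"
proof (rule finite_subset)
  show "{length vs | vs. is_cycle G vs} \<subseteq> {..card (verts G)}"
    using assms by (auto simp: is_cycle_def distinct_card[symmetric] intro: card_mono)
qed simp

section \<open>Graphs given by lists of edges\<close>

definition graph_of :: "nat \<Rightarrow> (nat \<times> nat) list \<Rightarrow> nat ugraph" where
  "graph_of n es = \<lparr>verts = {..<n}, edges = (\<lambda>(a, b). {a, b}) ` set es\<rparr>"

definition adjacent :: "(nat \<times> nat) list \<Rightarrow> nat \<Rightarrow> nat \<Rightarrow> bool" where
  "adjacent es u v \<longleftrightarrow> (u, v) \<in> set es \<or> (v, u) \<in> set es"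

lemma verts_graph_of [simp]: "verts (graph_of n es) = {..<n}"
  by (simp add: graph_of_def)

lemma edge_graph_of_iff: "{u, v} \<in> edges (graph_of n es) \<longleftrightarrow> adjacent es u v"
  by (auto simp: graph_of_def adjacent_def image_iff doubleton_eq_iff Bex_def)

lemma simple_graph_of:
  assumes "\<forall>(a, b)\<in>set es. a < n \<and> b < n \<and> a \<noteq> b"
  shows "simple_graph (graph_of n es)"
  using assms by (auto simp: simple_graph_def graph_of_def)

lemma is_cycle_graph_of_iff:
  "is_cycle (graph_of n es) vs \<longleftrightarrow>
     3 \<le> length vs \<and> distinct vs \<and> (\<forall>v\<in>set vs. v < n) \<and>
     (\<forall>i\<in>set [0..<length vs]. adjacent es (vs ! i) (vs ! (Suc i mod length vs)))"
  unfolding is_cycle_iff_mod edge_graph_of_iff by auto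

text \<open>A list of cycles that decides acyclicity of all induced subgraphs. The second conjunct
  is a finite test that replaces the search for further cycles: a set in which some vertex has
  at most one neighbour is not the vertex set of a cycle, so only the sets of minimum degree
  at least two have to contain a listed cycle.\<close>

definition acyclicity_obstructions :: "nat \<Rightarrow> (nat \<times> nat) list \<Rightarrow> nat list list \<Rightarrow> bool" where
  "acyclicity_obstructions n es Cs \<longleftrightarrow>
     (\<forall>C\<in>set Cs. is_cycle (graph_of n es) C) \<and>
     (\<forall>t\<in>set (subseqs [0..<n]).
        t \<noteq> [] \<and> (\<forall>v\<in>set t. 2 \<le> length (filter (adjacent es v) t)) \<longrightarrow>
        (\<exists>C\<in>set Cs. set C \<subseteq> set t))"

lemma filter_in_subseqs: "filter P xs \<in> set (subseqs xs)"
  by (induction xs) (auto simp: Let_def)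

lemma cycle_contains_obstruction:
  assumes "acyclicity_obstructions n es Cs" and "is_cycle (graph_of n es) vs"
  shows "\<exists>C\<in>set Cs. set C \<subseteq> set vs"
proof -
  define t where "t = filter (\<lambda>v. v \<in> set vs) [0..<n]"
  have sub: "set vs \<subseteq> {..<n}" and ne: "vs \<noteq> []" using assms(2) by (auto simp: is_cycle_def)
  have st: "set t = set vs" using sub by (auto simp: t_def)
  have dt: "distinct t" by (simp add: t_def)
  have "t \<in> set (subseqs [0..<n])"
    unfolding t_def by (rule filter_in_subseqs)
  moreover have "t \<noteq> []" using st ne by auto
  moreover have "2 \<le> length (filter (adjacent es v) t)" if v: "v \<in> set t" for v
  proof -
    from cycle_vertex_two_neighbours[OF assms(2)] v st
    obtain a b where ab: "a \<in> set t" "b \<in> set t" "a \<noteq> b" "adjacent es v a" "adjacent es v b"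
      by (metis edge_graph_of_iff)
    then have "card {a, b} \<le> card (set (filter (adjacent es v) t))"
      by (intro card_mono) auto
    also have "\<dots> = length (filter (adjacent es v) t)"
      by (rule distinct_card[OF distinct_filter[OF dt]])
    finally show ?thesis using ab(3) by simp
  qed
  ultimately show ?thesis using assms(1) st unfolding acyclicity_obstructions_def by metis
qed

lemma acyclic_induced_iff:
  assumes "acyclicity_obstructions n es Cs" and "S \<subseteq> {..<n}"
  shows "acyclic_graph (induced (graph_of n es) S) \<longleftrightarrow> (\<forall>C\<in>set Cs. \<not> set C \<subseteq> S)"
proof -
  have "(\<exists>vs. is_cycle (graph_of n es) vs \<and> set vs \<subseteq> S) \<longleftrightarrow> (\<exists>C\<in>set Cs. set C \<subseteq> S)"
    using cycle_contains_obstruction[OF assms(1)] assms(1) unfolding acyclicity_obstructions_def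
    by (meson order_trans)
  then show ?thesis
    using assms(2) by (simp add: acyclic_graph_def is_cycle_induced_iff)
qed

section \<open>Computing the coefficients\<close>

lemma card_subsets_eq_length_subseqs:
  assumes "distinct xs"
  shows "card {S. S \<subseteq> set xs \<and> P S} = length (filter (\<lambda>t. P (set t)) (subseqs xs))"
proof -
  let ?ts = "filter (\<lambda>t. P (set t)) (subseqs xs)"
  have "distinct (map set (subseqs xs))" by (rule distinct_set_subseqs[OF assms])
  then have "distinct (map set ?ts)" by (rule distinct_map_filter)
  then have "length ?ts = card (set (map set ?ts))" by (simp only: distinct_card length_map)
  also have "set (map set ?ts) = {S. S \<subseteq> set xs \<and> P S}"
  proof -
    have "{S. S \<subseteq> set xs \<and> P S} = {S \<in> set ` set (subseqs xs). P S}"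
      by (simp add: subseqs_powset)
    then show ?thesis by auto
  qed
  finally show ?thesis by simp
qed

definition avoiding_count :: "nat \<Rightarrow> nat list list \<Rightarrow> nat \<Rightarrow> nat" where
  "avoiding_count n Cs i =
     length (filter (\<lambda>t. length t = i \<and> (\<forall>C\<in>set Cs. \<not> set C \<subseteq> set t)) (subseqs [0..<n]))"

lemma acyclic_count_graph_of:
  assumes "acyclicity_obstructions n es Cs"
  shows "acyclic_count (graph_of n es) i = avoiding_count n Cs i"
proof -
  have "acyclic_count (graph_of n es) i =
      card {S. S \<subseteq> set [0..<n] \<and> (card S = i \<and> (\<forall>C\<in>set Cs. \<not> set C \<subseteq> S))}"
    unfolding acyclic_count_def
    by (rule arg_cong[where f = card]) (auto simp: acyclic_induced_iff[OF assms] lessThan_atLeast0)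
  also have "\<dots> = length (filter (\<lambda>t. card (set t) = i \<and> (\<forall>C\<in>set Cs. \<not> set C \<subseteq> set t))
      (subseqs [0..<n]))"
    by (rule card_subsets_eq_length_subseqs) simp
  also have "\<dots> = avoiding_count n Cs i"
    unfolding avoiding_count_def
    by (intro arg_cong[where f = length] filter_cong refl)
      (metis subseqs_distinctD distinct_upt distinct_card)
  finally show ?thesis .
qed

lemma acyclic_poly_eqI:
  assumes "acyclicity_obstructions n es Cs" and "acyclicity_obstructions n es' Cs'"
    and "\<forall>i\<in>set [0..<Suc n]. avoiding_count n Cs i = avoiding_count n Cs' i"
  shows "acyclic_poly (graph_of n es) = acyclic_poly (graph_of n es')"
  unfolding acyclic_poly_def acyclic_count_graph_of[OF assms(1)] acyclic_count_graph_of[OF assms(2)]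
  using assms(3) by (intro sum.cong) auto

section \<open>The two graphs on seven vertices\<close>

text \<open>The hexagon \<open>1, ..., 6\<close> with the centre \<open>0\<close>, which is joined to the odd vertices.\<close>

definition cube_minus_vertex_edges :: "(nat \<times> nat) list" where
  "cube_minus_vertex_edges =
     [(1,2), (2,3), (3,4), (4,5), (5,6), (6,1), (0,1), (0,3), (0,5)]"

definition chorded_heptagon_edges :: "(nat \<times> nat) list" where
  "chorded_heptagon_edges =
     [(0,1), (1,2), (2,3), (3,4), (4,5), (5,6), (6,0), (1,4), (2,5)]"

abbreviation cube_minus_vertex :: "nat ugraph" where
  "cube_minus_vertex \<equiv> graph_of 7 cube_minus_vertex_edges"

abbreviation chorded_heptagon :: "nat ugraph" where
  "chorded_heptagon \<equiv> graph_of 7 chorded_heptagon_edges"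

lemma acyclicity_obstructions_cube_minus_vertex:
  "acyclicity_obstructions 7 cube_minus_vertex_edges [[0,1,2,3], [0,3,4,5], [0,5,6,1], [1,2,3,4,5,6]]"
  unfolding acyclicity_obstructions_def is_cycle_graph_of_iff by code_simp

lemma acyclicity_obstructions_chorded_heptagon:
  "acyclicity_obstructions 7 chorded_heptagon_edges
     [[1,2,3,4], [2,3,4,5], [1,2,5,4], [0,1,2,5,6], [0,1,4,5,6]]"
  unfolding acyclicity_obstructions_def is_cycle_graph_of_iff by code_simp

lemma acyclic_poly_cube_minus_vertex_eq_chorded_heptagon:
  "acyclic_poly cube_minus_vertex = acyclic_poly chorded_heptagon"
  by (rule acyclic_poly_eqI[OF acyclicity_obstructions_cube_minus_vertex acyclicity_obstructions_chorded_heptagon])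
    code_simp

lemma bipartite_cube_minus_vertex: "bipartite cube_minus_vertex"
  unfolding bipartite_def
proof (intro exI conjI)
  show "{0, 2, 4, 6} \<union> {1, 3, 5} = verts cube_minus_vertex" by auto
  show "\<forall>e\<in>edges cube_minus_vertex. \<exists>x\<in>{0, 2, 4, 6}. \<exists>y\<in>{1, 3, 5}. e = {x, y}"
    by (simp add: graph_of_def cube_minus_vertex_edges_def doubleton_eq_iff)
qed simp

lemma cycle_cube_minus_vertex: "is_cycle cube_minus_vertex [0,1,2,3]"
  unfolding is_cycle_graph_of_iff by code_simp

lemma Hamiltonian_cycle_chorded_heptagon: "is_cycle chorded_heptagon [0,1,2,3,4,5,6]"
  unfolding is_cycle_graph_of_iff by code_simp

lemma not_bipartite_chorded_heptagon: "\<not> bipartite chorded_heptagon"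
  using bipartite_cycle_even[OF _ Hamiltonian_cycle_chorded_heptagon] by auto

text \<open>Parity makes it unnecessary to determine the longest cycles of this graph: the maximum
  is attained by some cycle, and all of them are even.\<close>

lemma even_circumference_cube_minus_vertex: "even (circumference cube_minus_vertex)"
proof -
  have "circumference cube_minus_vertex \<in> {length vs | vs. is_cycle cube_minus_vertex vs}"
    unfolding circumference_def
    using cycle_cube_minus_vertex by (intro Max_in finite_cycle_lengths) auto
  then show ?thesis using bipartite_cycle_even[OF bipartite_cube_minus_vertex] by auto
qed

lemma circumference_chorded_heptagon: "circumference chorded_heptagon = 7"
  unfolding circumference_def
proof (rule Max_eqI)
  show "finite {length vs | vs. is_cycle chorded_heptagon vs}"
    by (rule finite_cycle_lengths) simp
  show "7 \<in> {length vs | vs. is_cycle chorded_heptagon vs}"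
    using Hamiltonian_cycle_chorded_heptagon by force
next
  fix k assume "k \<in> {length vs | vs. is_cycle chorded_heptagon vs}"
  then obtain vs where vs: "k = length vs" "distinct vs" "set vs \<subseteq> {..<7::nat}"
    by (auto simp: is_cycle_def)
  then have "k = card (set vs)" by (simp add: distinct_card)
  also have "\<dots> \<le> card {..<7::nat}" using vs by (intro card_mono) auto
  finally show "k \<le> 7" by simp
qed

section \<open>The acyclic polynomial does not determine the three invariants\<close>

theorem theorem1p2:
  shows "(\<exists>(G :: nat ugraph) (H :: nat ugraph). simple_graph G \<and> simple_graph H \<and>
            acyclic_poly G = acyclic_poly H \<and>
            card (edges G) \<noteq> card (edges H)) \<and>
         (\<exists>(G :: nat ugraph) (H :: nat ugraph). simple_graph G \<and> simple_graph H \<and>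
            acyclic_poly G = acyclic_poly H \<and>
            bipartite G \<and> \<not> bipartite H) \<and>
         (\<exists>(G :: nat ugraph) (H :: nat ugraph). simple_graph G \<and> simple_graph H \<and>
            acyclic_poly G = acyclic_poly H \<and>
            \<not> acyclic_graph G \<and> \<not> acyclic_graph H \<and>
            circumference G \<noteq> circumference H)"
proof -
  have "acyclicity_obstructions 2 [(0, 1)] []" "acyclicity_obstructions 2 [] []"
    unfolding acyclicity_obstructions_def is_cycle_graph_of_iff by code_simp+
  then have two: "acyclic_poly (graph_of 2 [(0, 1)]) = acyclic_poly (graph_of 2 [])"
    by (rule acyclic_poly_eqI) simp
  have simple_two: "simple_graph (graph_of 2 [(0, 1)])" "simple_graph (graph_of 2 [])"
    by (simp_all add: simple_graph_of)
  have card_two: "card (edges (graph_of 2 [(0, 1)])) \<noteq> card (edges (graph_of 2 []))"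
    by (simp add: graph_of_def)
  have simple: "simple_graph cube_minus_vertex" "simple_graph chorded_heptagon"
    by (rule simple_graph_of; code_simp)+
  have cyclic: "\<not> acyclic_graph cube_minus_vertex" "\<not> acyclic_graph chorded_heptagon"
    using cycle_cube_minus_vertex Hamiltonian_cycle_chorded_heptagon
    by (auto simp: acyclic_graph_def)
  have "circumference cube_minus_vertex \<noteq> circumference chorded_heptagon"
    using even_circumference_cube_minus_vertex circumference_chorded_heptagon by auto
  with two simple_two card_two simple cyclic acyclic_poly_cube_minus_vertex_eq_chorded_heptagon
    bipartite_cube_minus_vertex not_bipartite_chorded_heptagon
  show ?thesis by blast
qed

end
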